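(* Let $C=(V,E)$ be an undirected cycle with two commodities given by vertex pairs $\{s_1,t_1\}$ and $\{s_2,t_2\}$ with $s_1\ne t_1$, $s_2\ne t_2$, and demands $r_1>0$, $r_2>0$; write $\mathbf r=(r_1,r_2)$. For $i\in\{1,2\}$ let $P_i$ be the set of $s_i$–$t_i$ paths in $C$, and let $P=P_1\cup P_2$. Let $f,f'$ be two feasible flows for $(C,(s_i,t_i)_{i=1,2},\mathbf r)$, i.e. each assigns a value $f(p)\ge 0$ (resp. $f'(p)\ge0$) to every path $p\in P_i$ of commodity $i$, with $\sum_{p\in P_i}f(p)=\sum_{p\in P_i}f'(p)=r_i$ for $i=1,2$. For each edge $e\in E$ let $f(e)$ (resp. $f'(e)$) be the total amount of flow, summed over both commodities, on all paths containing $e$. Then there exist $i\in\{1,2\}$ and a path $p\in P_i$ with $f(p)>0$ such that $f(e)\ge f'(e)$ for every edge $e\in p$.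
   Context: Paths are simple paths in the cycle; for each $i$, $P_i$ consists of exactly two edge-disjoint $s_i$–$t_i$ paths. The flow values of the two commodities are kept separate: if the same path of $C$ serves both commodities (e.g. when $\{s_1,t_1\}=\{s_2,t_2\}$), it carries a commodity-1 value and a commodity-2 value, and the edge load is $f(e)=\sum_{i=1}^{2}\sum_{p\in P_i,\ e\in p}f(p)$, similarly for $f'$. "$e\in p$" means the edge $e$ lies on the path $p$. *)

theory Defs
  imports Complex_Main
begin

text \<open>
  Undirected graphs are multigraphs given by an incidence map from edges to their sets of end
  vertices. A simple graph is the special case in which the map is injective on the edges; parallel
  edges are allowed so that the cycle of length two is covered as well.
\<close>

record ('v, 'e) ugraph =
  verts :: "'v set"
  edges :: "'e set"
  ends :: "'e \<Rightarrow> 'v set"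

definition is_cycle_graph :: "('v, 'e) ugraph \<Rightarrow> bool" where
  "is_cycle_graph C \<longleftrightarrow>
    (\<exists>vs es. length vs = length es \<and> 2 \<le> length vs \<and> distinct vs \<and> distinct es \<and>
      verts C = set vs \<and> edges C = set es \<and>
      (\<forall>i < length es. ends C (es ! i) = {vs ! i, vs ! (Suc i mod length vs)}))"

text \<open>
  A path is the pair of its vertex sequence and its edge sequence, read from \<open>s\<close> to \<open>t\<close>;
  the edge sequence is needed because of possible parallel edges.
\<close>

type_synonym ('v, 'e) upath = "'v list \<times> 'e list"

definition path_edges :: "('v, 'e) upath \<Rightarrow> 'e set" where
  "path_edges p = set (snd p)"

definition st_paths :: "('v, 'e) ugraph \<Rightarrow> 'v \<Rightarrow> 'v \<Rightarrow> ('v, 'e) upath set" where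
  "st_paths G s t = {(vs, es).
    length vs = Suc (length es) \<and> hd vs = s \<and> last vs = t \<and> distinct vs \<and>
    set vs \<subseteq> verts G \<and> set es \<subseteq> edges G \<and>
    (\<forall>i < length es. ends G (es ! i) = {vs ! i, vs ! Suc i})}"

text \<open>
  Commodities are indexed by \<open>{1, 2}\<close>. A flow \<open>f\<close> takes the commodity as its first argument, so
  that a path serving both commodities carries one value for each of them.
\<close>

definition feasible_flow ::
  "('v, 'e) ugraph \<Rightarrow> (nat \<Rightarrow> 'v) \<Rightarrow> (nat \<Rightarrow> 'v) \<Rightarrow> (nat \<Rightarrow> real)
    \<Rightarrow> (nat \<Rightarrow> ('v, 'e) upath \<Rightarrow> real) \<Rightarrow> bool" where
  "feasible_flow G s t r f \<longleftrightarrow>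
    (\<forall>i\<in>{1, 2}. (\<forall>p \<in> st_paths G (s i) (t i). 0 \<le> f i p) \<and>
      (\<Sum>p \<in> st_paths G (s i) (t i). f i p) = r i)"

definition edge_load ::
  "('v, 'e) ugraph \<Rightarrow> (nat \<Rightarrow> 'v) \<Rightarrow> (nat \<Rightarrow> 'v)
    \<Rightarrow> (nat \<Rightarrow> ('v, 'e) upath \<Rightarrow> real) \<Rightarrow> 'e \<Rightarrow> real" where
  "edge_load G s t f e =
    (\<Sum>i\<in>{1, 2}. \<Sum>p \<in> {p \<in> st_paths G (s i) (t i). e \<in> path_edges p}. f i p)"

end

theory Submission
  imports Defs
begin

text \<open>
  For each commodity the two paths are edge-disjoint, and \<open>f - f'\<close> takes opposite values \<open>d\<close> and
  \<open>-d\<close> on them, where \<open>d \<ge> 0\<close> for a suitable order of the two paths. Take the commodity with the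
  larger \<open>d\<close>: along its path with value \<open>d\<close> the other commodity cannot outweigh the increase.
  That path carries \<open>f\<close>-flow if \<open>d > 0\<close>; if \<open>d = 0\<close>, then \<open>f\<close> and \<open>f'\<close> have the same loads.
\<close>

section \<open>Paths in a cycle\<close>

text \<open>
  The vertices and edges of a cycle of length \<open>n\<close> are indexed by all integers, modulo \<open>n\<close>. This
  makes reversal of the orientation a substitution.
\<close>

definition cyclic_indexing ::
  "('v, 'e) ugraph \<Rightarrow> nat \<Rightarrow> (int \<Rightarrow> 'v) \<Rightarrow> (int \<Rightarrow> 'e) \<Rightarrow> bool" where
  "cyclic_indexing C n V E \<longleftrightarrow> 2 \<le> n \<and> verts C = range V \<and> edges C = range E \<and>
    (\<forall>x y. V x = V y \<longleftrightarrow> int n dvd x - y) \<and> (\<forall>x y. E x = E y \<longleftrightarrow> int n dvd x - y) \<and>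
    (\<forall>x. ends C (E x) = {V x, V (x + 1)})"

lemma nth_mod_eq_iff:
  assumes "distinct xs" and "xs \<noteq> []"
  shows "xs ! nat (x mod int (length xs)) = xs ! nat (y mod int (length xs)) \<longleftrightarrow>
    int (length xs) dvd x - y"
proof -
  have bound: "nat (z mod int (length xs)) < length xs" for z
    using assms(2) by (simp add: nat_less_iff)
  show ?thesis
    using assms bound by (simp add: nth_eq_iff_index_eq mod_eq_dvd_iff nat_eq_iff)
qed

lemma range_nth_mod:
  assumes "xs \<noteq> []"
  shows "range (\<lambda>x. xs ! nat (x mod int (length xs))) = set xs"
proof
  show "range (\<lambda>x. xs ! nat (x mod int (length xs))) \<subseteq> set xs"
    using assms by (auto simp: nat_less_iff)
  show "set xs \<subseteq> range (\<lambda>x. xs ! nat (x mod int (length xs)))"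
  proof
    fix v assume "v \<in> set xs"
    then obtain i where "i < length xs" "v = xs ! i" by (auto simp: in_set_conv_nth)
    then have "v = xs ! nat (int i mod int (length xs))" by simp
    then show "v \<in> range (\<lambda>x. xs ! nat (x mod int (length xs)))" by blast
  qed
qed

lemma is_cycle_graph_imp_cyclic_indexing:
  assumes "is_cycle_graph C"
  obtains n V E where "cyclic_indexing C n V E"
proof -
  obtain vs es where c: "length vs = length es" "2 \<le> length vs" "distinct vs" "distinct es"
      "verts C = set vs" "edges C = set es"
      "\<And>i. i < length es \<Longrightarrow> ends C (es ! i) = {vs ! i, vs ! (Suc i mod length vs)}"
    using assms unfolding is_cycle_graph_def by blast
  define n where "n = length es"
  define V where "V x = vs ! nat (x mod int n)" for x
  define E where "E x = es ! nat (x mod int n)" for x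
  have ne: "vs \<noteq> []" "es \<noteq> []" and n: "2 \<le> n" using c(1,2) n_def by auto
  have "ends C (E x) = {V x, V (x + 1)}" for x
  proof -
    have "nat (x mod int n) < n" using n by (simp add: nat_less_iff)
    \<comment> \<open>The wrap-around of \<open>is_cycle_graph\<close> on list positions is the
      integer successor reduced modulo \<open>n\<close>.\<close>
    moreover have "Suc (nat (x mod int n)) mod n = nat ((x + 1) mod int n)"
    proof -
      have "int (Suc (nat (x mod int n)) mod n) = (x mod int n + 1) mod int n"
        using n by (simp add: zmod_int add.commute)
      also have "\<dots> = (x + 1) mod int n" by (simp add: mod_add_left_eq)
      finally show ?thesis by (metis nat_int)
    qed
    ultimately show ?thesis using c(1,7) by (simp add: E_def V_def n_def)
  qed
  then have "cyclic_indexing C n V E"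
    unfolding cyclic_indexing_def
    using c(1,5,6) n nth_mod_eq_iff[OF c(3) ne(1)] nth_mod_eq_iff[OF c(4) ne(2)]
      range_nth_mod[OF ne(1)] range_nth_mod[OF ne(2)]
    by (simp add: V_def E_def n_def)
  then show thesis by (rule that)
qed

text \<open>Edge \<open>E x\<close> leads from position \<open>x\<close> to \<open>x + 1\<close>.
  After negation the edge between positions \<open>- x\<close> and \<open>- x - 1\<close> has to get
  index \<open>x\<close>, hence the shift by one for edges only.\<close>

lemma cyclic_indexing_reverse:
  assumes "cyclic_indexing C n V E"
  shows "cyclic_indexing C n (\<lambda>x. V (- x)) (\<lambda>x. E (- x - 1))"
proof -
  have "range (\<lambda>x. V (- x)) = range V"
    by (auto simp: image_iff) (metis minus_minus)
  moreover have "range (\<lambda>x. E (- x - 1)) = range E"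
  proof -
    have "E x = E (- (- x - 1) - 1)" for x by simp
    then show ?thesis by blast
  qed
  moreover have "int n dvd y - x \<longleftrightarrow> int n dvd x - y" for x y :: int
    by (simp add: dvd_diff_commute)
  moreover have "- (x + 1) = - x - 1" "- x - 1 + 1 = - x" for x :: int by auto
  ultimately show ?thesis
    using assms unfolding cyclic_indexing_def by (simp add: insert_commute)
qed

text \<open>Only the edges with indices \<open>b\<close> and \<open>b - 1\<close> meet
  \<open>V b\<close>. The conclusion records the edge index as well as the far end, because for
  \<open>n = 2\<close> both edges have the same far end.\<close>

lemma edge_at_vertex:
  assumes "cyclic_indexing C n V E" and "ends C (E y) = {V b, w}"
  shows "int n dvd y - b \<and> w = V (b + 1) \<or> int n dvd y + 1 - b \<and> w = V (b - 1)"
proof -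
  have V: "V x = V z \<longleftrightarrow> int n dvd x - z" for x z
    using assms(1) by (auto simp: cyclic_indexing_def)
  have e: "ends C (E y) = {V y, V (y + 1)}"
    using assms(1) by (auto simp: cyclic_indexing_def)
  have "V b = V y \<and> w = V (y + 1) \<or> V b = V (y + 1) \<and> w = V y"
    using assms(2) unfolding e doubleton_eq_iff by metis
  then show ?thesis
  proof
    assume a: "V b = V y \<and> w = V (y + 1)"
    then have "int n dvd y - b" using V by metis
    moreover from this have "V (y + 1) = V (b + 1)" by (simp add: V)
    ultimately show ?thesis using a by simp
  next
    assume a: "V b = V (y + 1) \<and> w = V y"
    then have d: "int n dvd y + 1 - b" using V by metis
    moreover have "V y = V (b - 1)" using d by (simp add: V algebra_simps)
    ultimately show ?thesis using a by simp
  qed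
qed

text \<open>The walk of \<open>k\<close> edges from position \<open>a\<close> in increasing
  direction. Arcs in the other direction are obtained by passing the reversed indexing.\<close>

definition arc :: "(int \<Rightarrow> 'v) \<Rightarrow> (int \<Rightarrow> 'e) \<Rightarrow> int \<Rightarrow> nat \<Rightarrow> ('v, 'e) upath" where
  "arc V E a k = (map (\<lambda>j. V (a + int j)) [0..<Suc k], map (\<lambda>j. E (a + int j)) [0..<k])"

lemma path_edges_arc: "path_edges (arc V E a k) = (\<lambda>j. E (a + int j)) ` {..<k}"
  by (simp add: path_edges_def arc_def atLeast0LessThan)

text \<open>The first edge fixes the direction: by induction, each later edge must continue forward,
  since going back would repeat a vertex.\<close>

lemma path_eq_arc:
  assumes cyc: "cyclic_indexing C n V E"
    and path: "(vs, es) \<in> st_paths C s t" and "s \<noteq> t"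
    and start: "vs ! 0 = V a" "vs ! 1 = V (a + 1)" "es ! 0 = E a"
  obtains k where "k < n" "V (a + int k) = t" "(vs, es) = arc V E a k"
proof -
  have V: "V x = V z \<longleftrightarrow> int n dvd x - z" and E: "E x = E z \<longleftrightarrow> int n dvd x - z" for x z
    using cyc by (auto simp: cyclic_indexing_def)
  have p: "length vs = Suc (length es)" "last vs = t" "distinct vs"
      "set es \<subseteq> range E"
      "\<And>i. i < length es \<Longrightarrow> ends C (es ! i) = {vs ! i, vs ! Suc i}"
    using path cyc by (auto simp: st_paths_def cyclic_indexing_def)
  have step: "j < length es \<longrightarrow> vs ! j = V (a + int j) \<and> vs ! Suc j = V (a + int j + 1) \<and>
      es ! j = E (a + int j)" for j
  proof (induction j)
    case 0
    then show ?case using start by simp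
  next
    case (Suc j)
    show ?case
    proof
      assume j: "Suc j < length es"
      then have IH: "vs ! j = V (a + int j)" "vs ! Suc j = V (a + int j + 1)"
        using Suc by auto
      obtain y where y: "es ! Suc j = E y"
        using p(4) j by (metis nth_mem subsetD imageE)
      have "ends C (E y) = {V (a + int j + 1), vs ! Suc (Suc j)}"
        using p(5)[OF j] IH y by simp
      from edge_at_vertex[OF cyc this]
      have "int n dvd y - (a + int j + 1) \<and> vs ! Suc (Suc j) = V (a + int j + 1 + 1)
        \<or> vs ! Suc (Suc j) = V (a + int j)" by auto
      \<comment> \<open>This excludes the backward alternative, whose far end is the vertex visited
        just before.\<close>
      moreover have "vs ! Suc (Suc j) \<noteq> vs ! j"
        using p(1,3) j by (simp add: nth_eq_iff_index_eq)
      ultimately have "es ! Suc j = E (a + int j + 1)"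
          "vs ! Suc (Suc j) = V (a + int j + 1 + 1)"
        using IH y E by auto
      then show "vs ! Suc j = V (a + int (Suc j)) \<and>
          vs ! Suc (Suc j) = V (a + int (Suc j) + 1) \<and> es ! Suc j = E (a + int (Suc j))"
        using IH by (simp add: algebra_simps)
    qed
  qed
  have vtx: "vs ! j = V (a + int j)" if "j \<le> length es" for j
  proof (cases j)
    case 0
    then show ?thesis using start by simp
  next
    case (Suc i)
    then show ?thesis using step[of i] that by (simp add: algebra_simps)
  qed
  have "length es < n"
  proof (rule ccontr)
    assume "\<not> length es < n"
    then have n: "n \<le> length es" by simp
    \<comment> \<open>\<open>V\<close> has period \<open>n\<close>, so a path with \<open>n\<close>
      or more edges would return to its start.\<close>
    have "vs ! n = vs ! 0" using vtx[OF n] vtx[of 0] by (simp add: V)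
    moreover have "n \<noteq> 0" using cyc by (auto simp: cyclic_indexing_def)
    ultimately show False using p(1,3) n by (simp add: nth_eq_iff_index_eq)
  qed
  moreover have "V (a + int (length es)) = t"
    using vtx[of "length es"] p(1,2) by (metis diff_Suc_1 last_conv_nth length_0_conv nat.simps(3) order_refl)
  moreover have "(vs, es) = arc V E a (length es)"
    using vtx step p(1) unfolding arc_def
    by (auto intro!: nth_equalityI simp del: upt_Suc)
  ultimately show thesis by (rule that)
qed

text \<open>The first edge is \<open>E a\<close> or \<open>E (a - 1)\<close>. The second case is
  \<open>path_eq_arc\<close> for the reversed indexing, in which the start has position
  \<open>- a\<close>.\<close>

lemma path_eq_arc_either_direction:
  assumes cyc: "cyclic_indexing C n V E"
    and path: "p \<in> st_paths C (V a) t" and ne: "V a \<noteq> t"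
  shows "(\<exists>k<n. V (a + int k) = t \<and> p = arc V E a k) \<or>
    (\<exists>k<n. V (a - int k) = t \<and> p = arc (\<lambda>x. V (- x)) (\<lambda>x. E (- x - 1)) (- a) k)"
proof -
  obtain vs es where p: "p = (vs, es)" by (cases p)
  have q: "length vs = Suc (length es)" "hd vs = V a" "last vs = t"
      "set es \<subseteq> range E"
      "\<And>i. i < length es \<Longrightarrow> ends C (es ! i) = {vs ! i, vs ! Suc i}"
    using path cyc p by (auto simp: st_paths_def cyclic_indexing_def)
  have E: "E x = E z \<longleftrightarrow> int n dvd x - z" for x z
    using cyc by (auto simp: cyclic_indexing_def)
  have "vs \<noteq> []" using q(1) by auto
  then have v0: "vs ! 0 = V a" using q(2) by (simp add: hd_conv_nth)
  have l: "0 < length es"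
  proof (rule ccontr)
    assume "\<not> 0 < length es"
    then have "length vs = 1" using q(1) by simp
    then have "hd vs = last vs" by (cases vs) auto
    then show False using q(2,3) ne by simp
  qed
  obtain y where y: "es ! 0 = E y" using q(4) l by (metis nth_mem subsetD imageE)
  have "ends C (E y) = {V a, vs ! 1}" using q(5)[OF l] y v0 by simp
  from edge_at_vertex[OF cyc this] show ?thesis
  proof
    assume "int n dvd y - a \<and> vs ! 1 = V (a + 1)"
    then have "vs ! 1 = V (a + 1)" "es ! 0 = E a" using y E by auto
    from path_eq_arc[OF cyc path[unfolded p] ne v0 this] show ?thesis unfolding p by metis
  next
    assume *: "int n dvd y + 1 - a \<and> vs ! 1 = V (a - 1)"
    then have "vs ! 1 = V (- (- a + 1))" by simp
    moreover have "es ! 0 = E (- (- a) - 1)" using * y E by (simp add: algebra_simps)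
    moreover have "vs ! 0 = V (- (- a))" using v0 by simp
    ultimately obtain k where "k < n" "V (- (- a + int k)) = t"
        "(vs, es) = arc (\<lambda>x. V (- x)) (\<lambda>x. E (- x - 1)) (- a) k"
      using path_eq_arc[OF cyclic_indexing_reverse[OF cyc] path[unfolded p] ne] by metis
    then show ?thesis unfolding p by auto
  qed
qed

text \<open>In each direction the end vertex determines the length of the arc modulo
  \<open>n\<close>, and the length is below \<open>n\<close>. This leaves one candidate per
  direction.\<close>

lemma cycle_st_paths:
  assumes "is_cycle_graph C" and "s \<in> verts C" "t \<in> verts C" "s \<noteq> t"
  obtains A B where "st_paths C s t \<subseteq> {A, B}" "path_edges A \<inter> path_edges B = {}"
proof -
  obtain n V E where cyc: "cyclic_indexing C n V E"
    using is_cycle_graph_imp_cyclic_indexing[OF assms(1)] .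
  have V: "V x = V z \<longleftrightarrow> int n dvd x - z" and E: "E x = E z \<longleftrightarrow> int n dvd x - z" for x z
    using cyc by (auto simp: cyclic_indexing_def)
  have n: "2 \<le> n" using cyc by (simp add: cyclic_indexing_def)
  obtain a c where a: "s = V a" and c: "t = V c"
    using assms(2,3) cyc by (auto simp: cyclic_indexing_def)
  \<comment> \<open>The forward distance from \<open>s\<close> to \<open>t\<close>; the backward one
    is then \<open>n - l\<close>.\<close>
  define l where "l = nat ((c - a) mod int n)"
  have li: "int l = (c - a) mod int n" using n by (simp add: l_def)
  have t: "t = V (a + int l)"
    unfolding c V li by (metis diff_diff_eq dvd_minus_mod)
  have "l < n" using li n by (metis of_nat_less_iff pos_mod_bound of_nat_0_less_iff
        less_le_trans pos2)
  have "0 < l" using t a assms(4) by (cases l) auto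
  define A where "A = arc V E a l"
  define B where "B = arc (\<lambda>x. V (- x)) (\<lambda>x. E (- x - 1)) (- a) (n - l)"
  have "p \<in> {A, B}" if "p \<in> st_paths C s t" for p
    using path_eq_arc_either_direction[OF cyc that[unfolded a] assms(4)[unfolded a]]
  proof
    assume "\<exists>k<n. V (a + int k) = t \<and> p = arc V E a k"
    then obtain k where k: "k < n" "V (a + int k) = t" "p = arc V E a k" by blast
    have "int n dvd int k - int l" using k(2) t by (simp add: V)
    then have "int k mod int n = int l mod int n" by (simp add: mod_eq_dvd_iff)
    then have "k = l" using k(1) \<open>l < n\<close> by simp
    then show ?thesis using k(3) A_def by simp
  next
    assume "\<exists>k<n. V (a - int k) = t \<and> p = arc (\<lambda>x. V (- x)) (\<lambda>x. E (- x - 1)) (- a) k"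
    then obtain k where k: "k < n" "V (a - int k) = t"
        "p = arc (\<lambda>x. V (- x)) (\<lambda>x. E (- x - 1)) (- a) k" by blast
    \<comment> \<open>Going \<open>l\<close> forward and \<open>k\<close> backward ends at the same
      vertex, so \<open>n\<close> divides \<open>l + k\<close>; strictly between \<open>0\<close>
      and \<open>2 * n\<close> the only multiple is \<open>n\<close>.\<close>
    have "V (a + int l) = V (a - int k)" using k(2) t by simp
    then have "int n dvd int (l + k)" by (simp add: V)
    then have "n dvd l + k" by (simp only: int_dvd_int_iff)
    then obtain m where m: "l + k = n * m" by (auto elim: dvdE)
    moreover have "0 < l + k" "l + k < n * 2" using \<open>0 < l\<close> \<open>l < n\<close> k(1) by auto
    ultimately have "m = 1" by (cases m) auto
    then have "k = n - l" using m by simp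
    then show ?thesis using k(3) B_def by simp
  qed
  moreover have "path_edges A \<inter> path_edges B = {}"
  proof (rule ccontr)
    assume "path_edges A \<inter> path_edges B \<noteq> {}"
    then obtain i j where ij: "i < l" "j < n - l" "E (a + int i) = E (- (- a + int j) - 1)"
      unfolding A_def B_def path_edges_arc by blast
    \<comment> \<open>A common edge makes \<open>i + j + 1\<close> a multiple of \<open>n\<close>,
      but the bounds in \<open>ij\<close> place it strictly between \<open>0\<close> and
      \<open>n\<close>.\<close>
    then have "int n dvd int (i + j + 1)" by (simp add: E algebra_simps)
    then have "n dvd i + j + 1" by (simp only: int_dvd_int_iff)
    then have "n \<le> i + j + 1" by (rule dvd_imp_le) simp
    then show False using ij(1,2) by linarith
  qed
  ultimately show thesis using that by blast
qed

section \<open>Comparison of the two flows\<close>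

text \<open>Each edge lies on at most one of the two paths, so this commodity changes its load by
  \<open>d\<close>, \<open>- d\<close> or \<open>0\<close>. The witness \<open>p\<close> is the path
  that gains, or any path with positive flow if \<open>d = 0\<close>.\<close>

lemma commodity_deviation:
  fixes f f' :: "('v, 'e) upath \<Rightarrow> real"
  assumes sub: "P \<subseteq> {A, B}" and disj: "path_edges A \<inter> path_edges B = {}"
    and nonneg: "\<And>p. p \<in> P \<Longrightarrow> 0 \<le> f' p"
    and sums: "sum f P = sum f' P" and pos: "0 < sum f P"
  obtains d p where
    "\<And>e. \<bar>\<Sum>q \<in> {q \<in> P. e \<in> path_edges q}. f q - f' q\<bar> \<le> d"
    "p \<in> P" "0 < f p"
    "\<And>e. e \<in> path_edges p \<Longrightarrow> (\<Sum>q \<in> {q \<in> P. e \<in> path_edges q}. f q - f' q) = d"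
proof -
  note concl = that
  let ?D = "\<lambda>e. \<Sum>q \<in> {q \<in> P. e \<in> path_edges q}. f q - f' q"
  have equal: thesis if "\<And>q. q \<in> P \<Longrightarrow> f q = f' q"
  proof -
    have "?D e = 0" for e using that by (intro sum.neutral) auto
    moreover obtain p where "p \<in> P" "0 < f p"
      using pos by (meson leD leI sum_nonpos)
    ultimately show thesis using concl[of 0 p] by simp
  qed
  have increasing: thesis
    if P: "P = {X, Y}" "X \<noteq> Y" and XY: "path_edges X \<inter> path_edges Y = {}" and inc: "f' X < f X"
    for X Y
  proof -
    \<comment> \<open>Both flows have the same total, so what \<open>X\<close> gains is lost on
      \<open>Y\<close>.\<close>
    have Y: "f Y - f' Y = - (f X - f' X)" using sums P by simp
    have D: "?D e = (if e \<in> path_edges X then f X - f' X else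
        if e \<in> path_edges Y then - (f X - f' X) else 0)" for e
    proof -
      have "{q \<in> P. e \<in> path_edges q} = (if e \<in> path_edges X then {X} else
        if e \<in> path_edges Y then {Y} else {})" using XY P(1) by auto
      then show ?thesis using Y by simp
    qed
    \<comment> \<open>A strict gain over the nonnegative value \<open>f' X\<close> makes
      \<open>f X\<close> positive.\<close>
    have "X \<in> P" "0 < f X" using P inc nonneg[of X] by auto
    then show thesis using D inc by (intro concl[of "f X - f' X" X]) auto
  qed
  show thesis
  proof (cases "P = {A, B} \<and> A \<noteq> B")
    case True
    then have "f A + f B = f' A + f' B" using sums by simp
    then consider "f' A < f A" | "f' B < f B" | "f A = f' A \<and> f B = f' B" by linarith
    then show thesis
    proof cases
      case 1
      then show thesis using True disj increasing[of A B] by blast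
    next
      case 2
      then show thesis using True disj increasing[of B A] by blast
    next
      case 3
      then show thesis using True by (intro equal) auto
    qed
  next
    case False
    \<comment> \<open>With at most one path the common total already forces equal flows.\<close>
    then have "P = {} \<or> P = {A} \<or> P = {B}" using sub by auto
    then show thesis using sums by (intro equal) auto
  qed
qed

theorem theorem2p2:
  fixes C :: "('v, 'e) ugraph"
    and s t :: "nat \<Rightarrow> 'v"
    and r :: "nat \<Rightarrow> real"
    and f f' :: "nat \<Rightarrow> ('v, 'e) upath \<Rightarrow> real"
  assumes "is_cycle_graph C"
    and "\<forall>i\<in>{1, 2}. s i \<in> verts C \<and> t i \<in> verts C \<and> s i \<noteq> t i"
    and "\<forall>i\<in>{1, 2}. 0 < r i"
    and "feasible_flow C s t r f"
    and "feasible_flow C s t r f'"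
  shows "\<exists>i\<in>{1, 2}. \<exists>p \<in> st_paths C (s i) (t i). 0 < f i p \<and>
    (\<forall>e \<in> path_edges p. edge_load C s t f' e \<le> edge_load C s t f e)"
proof -
  \<comment> \<open>The part of the load change on \<open>e\<close> that is due to commodity
    \<open>i\<close>.\<close>
  define D where "D i e = (\<Sum>q \<in> {q \<in> st_paths C (s i) (t i). e \<in> path_edges q}.
    f i q - f' i q)" for i e
  have load: "edge_load C s t f e - edge_load C s t f' e = D 1 e + D 2 e" for e
    by (simp add: edge_load_def D_def sum_subtractf)
  have dev: "\<exists>d p. (\<forall>e. \<bar>D i e\<bar> \<le> d) \<and> p \<in> st_paths C (s i) (t i) \<and> 0 < f i p \<and>
      (\<forall>e \<in> path_edges p. D i e = d)" if i: "i \<in> {1, 2}" for i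
  proof -
    obtain A B where AB: "st_paths C (s i) (t i) \<subseteq> {A, B}" "path_edges A \<inter> path_edges B = {}"
      using cycle_st_paths[OF assms(1)] assms(2) i by metis
    have "\<And>p. p \<in> st_paths C (s i) (t i) \<Longrightarrow> 0 \<le> f' i p"
        "sum (f i) (st_paths C (s i) (t i)) = sum (f' i) (st_paths C (s i) (t i))"
        "0 < sum (f i) (st_paths C (s i) (t i))"
      using assms(3-5) i unfolding feasible_flow_def by auto
    from commodity_deviation[OF AB this] obtain d p where
        "\<And>e. \<bar>D i e\<bar> \<le> d" "p \<in> st_paths C (s i) (t i)" "0 < f i p"
        "\<And>e. e \<in> path_edges p \<Longrightarrow> D i e = d"
      unfolding D_def by blast
    then show ?thesis by blast
  qed
  obtain d1 p1 where 1: "\<And>e. \<bar>D 1 e\<bar> \<le> d1" "p1 \<in> st_paths C (s 1) (t 1)" "0 < f 1 p1"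
      "\<And>e. e \<in> path_edges p1 \<Longrightarrow> D 1 e = d1"
    using dev[of 1] by blast
  obtain d2 p2 where 2: "\<And>e. \<bar>D 2 e\<bar> \<le> d2" "p2 \<in> st_paths C (s 2) (t 2)" "0 < f 2 p2"
      "\<And>e. e \<in> path_edges p2 \<Longrightarrow> D 2 e = d2"
    using dev[of 2] by blast
  show ?thesis
  proof (cases "d2 \<le> d1")
    case True
    \<comment> \<open>On \<open>p1\<close> commodity 1 adds exactly \<open>d1\<close>, while
      commodity 2 takes away at most \<open>d2\<close>.\<close>
    have "edge_load C s t f' e \<le> edge_load C s t f e" if "e \<in> path_edges p1" for e
      using load[of e] 1(4)[OF that] 2(1)[of e] True by linarith
    then show ?thesis using 1(2,3) by blast
  next
    case False
    have "edge_load C s t f' e \<le> edge_load C s t f e" if "e \<in> path_edges p2" for e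
      using load[of e] 2(4)[OF that] 1(1)[of e] False by linarith
    then show ?thesis using 2(2,3) by blast
  qed
qed

end
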